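(* Let $t>0$ and let $p$ be a complex polynomial of degree $n\ge 1$ (not necessarily monic). Then the inradius of the lemniscate $\Lambda_p(t)$ satisfies $$\rho(\Lambda_p(t))\ge \frac{1}{72\pi\sqrt{\pi}}\,\frac{\sqrt{m(\Lambda_p(t))}}{n}.$$
   Context: $\Lambda_p(t)=\{z\in\mathbb{C}:|p(z)|\le t\}$, and $m$ is Lebesgue measure on $\mathbb{C}$. The inradius $\rho$ of a set is the radius of the largest open disc contained in it (supremum of the radii of such discs); it is the same for $\{|p|\le t\}$ and for its interior $\{|p|<t\}$. *)

theory Defs
  imports "HOL-Analysis.Analysis" "HOL-Computational_Algebra.Polynomial"
begin

definition lemniscate :: "complex poly \<Rightarrow> real \<Rightarrow> complex set" where
  "lemniscate p t = {z. norm (poly p z) \<le> t}"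

(* Radius 0 is admitted (an empty disc), so that sets with empty interior have inradius 0.
   The supremum is the real-valued one and is only meaningful if the radii are bounded,
   in particular for bounded sets; see bdd_above_inradius. *)
definition inradius :: "complex set \<Rightarrow> real" where
  "inradius S = Sup {r. 0 \<le> r \<and> (\<exists>c. ball c r \<subseteq> S)}"

lemma bdd_above_inradius:
  assumes "bounded S"
  shows "bdd_above {r. 0 \<le> r \<and> (\<exists>c::complex. ball c r \<subseteq> S)}"
proof (rule bdd_aboveI[of _ "diameter S"])
  fix r assume "r \<in> {r. 0 \<le> r \<and> (\<exists>c::complex. ball c r \<subseteq> S)}"
  then obtain c where r: "0 \<le> r" "ball c r \<subseteq> S" by auto
  have "diameter (ball c r) \<le> diameter S"
    using r assms by (intro diameter_subset)
  then show "r \<le> diameter S"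
    using r by (auto simp: diameter_ball split: if_splits)
qed

lemma bounded_lemniscate:
  assumes "degree p \<ge> 1"
  shows "bounded (lemniscate p t)"
proof -
  have "filterlim (poly p) at_infinity at_infinity"
    using assms by (intro filterlim_poly_at_infinity) auto
  then have "eventually (\<lambda>z. norm (poly p z) \<ge> \<bar>t\<bar> + 1) at_infinity"
    by (subst (asm) filterlim_at_infinity[of 0]) auto
  then obtain b where "\<And>z. norm z \<ge> b \<Longrightarrow> norm (poly p z) \<ge> \<bar>t\<bar> + 1"
    unfolding eventually_at_infinity by blast
  then have "norm z \<le> b" if "norm (poly p z) \<le> t" for z
    using that by (smt (verit))
  then show ?thesis
    unfolding bounded_iff lemniscate_def by blast
qed

end

theory Submission
  imports Defs "HOL-Computational_Algebra.Fundamental_Theorem_Algebra"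
begin

text \<open>
  Let \<open>X\<close> be the multiset of the zeros of \<open>p\<close> and of \<open>p'\<close>, and let \<open>m\<close> be the area of the
  lemniscate. The kernel \<open>1 / |z - x|\<close> has average \<open>O(1 / sqrt m)\<close> over any set of area \<open>m\<close>, so
  some point \<open>z\<close> of the lemniscate satisfies \<open>S(z) = (\<Sum>x\<in>#X. 1 / |z - x|) = O(n / sqrt m)\<close>.
  On a disc around \<open>z\<close> of radius a small multiple of \<open>1 / S(z)\<close>, both \<open>p\<close> and \<open>p'\<close> change by a
  small factor only. Hence \<open>p\<close> is nearly affine there, and moving from \<open>z\<close> in the direction that
  decreases \<open>|p|\<close> gives a disc of comparable radius on which \<open>|p| \<le> |p(z)|\<close>.
\<close>

section \<open>Averaging the kernel over a set of given area\<close>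

text \<open>Dyadic shells: where \<open>R / 2 ^ Suc k \<le> norm (x - a) < R / 2 ^ k\<close>, the
  \<open>k\<close>-th term alone is large enough; outside the disc of radius \<open>R\<close> the
  constant is. Integrating the kernel thus reduces to areas of discs.\<close>

lemma inverse_norm_le_suminf_balls:
  fixes x a :: complex
  assumes "R > 0"
  shows "ennreal (1 / norm (x - a)) \<le>
    ennreal (1 / R) + (\<Sum>k. ennreal (2 ^ Suc k / R) * indicator (ball a (R / 2 ^ k)) x)"
    (is "_ \<le> _ + suminf ?f")
\<comment> \<open>The point \<open>x = a\<close> is harmless because
  \<open>1 / 0 = 0\<close>.\<close>
proof (cases "x = a \<or> norm (x - a) \<ge> R")
  case True
  then have "1 / norm (x - a) \<le> 1 / R"
    using assms by (auto simp: frac_le)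
  then have "ennreal (1 / norm (x - a)) \<le> ennreal (1 / R)"
    using assms by (intro ennreal_leI) auto
  then show ?thesis
    by (simp add: add_increasing2)
next
  case False
  define d where "d = norm (x - a)"
  have d: "0 < d" "d < R" using False by (auto simp: d_def)
  have "\<exists>k. R / 2 ^ k \<le> d"
    using real_arch_pow[of 2 "R / d"] d by (auto simp: field_simps intro: less_imp_le)
  then obtain k where k: "R / 2 ^ k \<le> d" "\<And>j. j < k \<Longrightarrow> d < R / 2 ^ j"
    using exists_least_iff[of "\<lambda>k. R / 2 ^ k \<le> d"] by (auto simp: not_le)
  moreover have "k \<noteq> 0" using k d by (intro notI) auto
  ultimately obtain i where "R / 2 ^ Suc i \<le> d" "d < R / 2 ^ i"
    by (cases k) auto
  then have *: "d < R / 2 ^ i" "1 / d \<le> 2 ^ Suc i / R"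
    using d assms by (auto simp: field_simps)
  have "ennreal (1 / d) \<le> ennreal (2 ^ Suc i / R)"
    using * by (intro ennreal_leI)
  also have "\<dots> = ?f i"
    using * by (auto simp: d_def dist_norm norm_minus_commute)
  also have "\<dots> = sum ?f {i}" by (simp only: sum.insert_if sum.empty finite.emptyI) simp
  also have "\<dots> \<le> suminf ?f" by (rule sum_le_suminf) auto
  finally show ?thesis by (simp add: d_def add_increasing)
qed

text \<open>The constant part of the dyadic majorant contributes \<open>m / R\<close>. The
  \<open>k\<close>-th disc contributes \<open>2 * pi * R / 2 ^ k\<close>, and these sum to
  \<open>4 * pi * R\<close>.\<close>

lemma nn_integral_inverse_norm_le:
  fixes A :: "complex set"
  assumes A: "A \<in> sets lborel" and m: "emeasure lborel A = ennreal m" "m > 0"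
  shows "(\<integral>\<^sup>+z\<in>A. ennreal (1 / norm (z - a)) \<partial>lborel) \<le> ennreal (4 * sqrt (pi * m))"
proof -
  \<comment> \<open>This radius balances the two contributions:
    \<open>m / R = 4 * pi * R\<close>.\<close>
  define R where "R = sqrt (m / (4 * pi))"
  have R: "R > 0" using m by (simp add: R_def)
  let ?f = "\<lambda>k x. ennreal (2 ^ Suc k / R) * indicator (ball a (R / 2 ^ k)) x"
  have meas [measurable]: "ball a r \<in> sets borel" for r by simp
  note [measurable] = A
  have "(\<integral>\<^sup>+z\<in>A. ennreal (1 / norm (z - a)) \<partial>lborel) \<le>
      (\<integral>\<^sup>+z. ennreal (1 / R) * indicator A z + (\<Sum>k. ?f k z) \<partial>lborel)"
    using inverse_norm_le_suminf_balls[OF R, of _ a]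
    by (intro nn_integral_mono) (auto simp: indicator_def)
  also have "\<dots> = ennreal (1 / R) * emeasure lborel A + (\<integral>\<^sup>+z. (\<Sum>k. ?f k z) \<partial>lborel)"
    using A by (subst nn_integral_add) (auto simp: nn_integral_cmult_indicator)
  also have "(\<integral>\<^sup>+z. (\<Sum>k. ?f k z) \<partial>lborel) = (\<Sum>k. \<integral>\<^sup>+z. ?f k z \<partial>lborel)"
    by (intro nn_integral_suminf) auto
  also have "\<dots> = (\<Sum>k. ennreal (2 * pi * R * (1 / 2) ^ k))"
  proof (intro suminf_cong)
    fix k
    have "(\<integral>\<^sup>+z. ?f k z \<partial>lborel) =
        ennreal (2 ^ Suc k / R) * emeasure lborel (ball a (R / 2 ^ k))"
      by (intro nn_integral_cmult_indicator) auto
    also have "emeasure lborel (ball a (R / 2 ^ k)) = ennreal (pi * (R / 2 ^ k)\<^sup>2)"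
      using R by (subst emeasure_ball) (auto simp: unit_ball_vol_2 ennreal_mult')
    also have "ennreal (2 ^ Suc k / R) * \<dots> = ennreal (2 ^ Suc k / R * (pi * (R / 2 ^ k)\<^sup>2))"
      using R by (subst ennreal_mult'[symmetric]) auto
    also have "2 ^ Suc k / R * (pi * (R / 2 ^ k)\<^sup>2) = 2 * pi * R * (1 / 2) ^ k"
      using R by (simp add: field_simps power2_eq_square)
    finally show "(\<integral>\<^sup>+z. ?f k z \<partial>lborel) = ennreal (2 * pi * R * (1 / 2) ^ k)" .
  qed
  also have "\<dots> = ennreal (4 * pi * R)"
  proof (rule suminf_ennreal_eq)
    have "(\<lambda>k. (1 / 2 :: real) ^ k) sums (1 / (1 - 1 / 2))"
      by (rule geometric_sums) auto
    from sums_mult[OF this, of "2 * pi * R"]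
    show "(\<lambda>k. 2 * pi * R * (1 / 2) ^ k) sums (4 * pi * R)" by (simp add: mult.assoc)
  qed (use R in auto)
  also have "ennreal (1 / R) * emeasure lborel A + ennreal (4 * pi * R) =
      ennreal (1 / R * m + 4 * pi * R)"
    unfolding m(1) using R m
    by (subst ennreal_mult'[symmetric]; (subst ennreal_plus[symmetric])?) auto
  also have "1 / R * m + 4 * pi * R = 4 * sqrt (pi * m)"
  proof -
    have "1 / R * m = 2 * sqrt pi * sqrt m" "4 * pi * R = 2 * sqrt pi * sqrt m"
      using m real_sqrt_mult_self[of m] real_sqrt_mult_self[of pi]
      by (auto simp: R_def real_sqrt_divide real_sqrt_mult field_simps
          simp del: real_sqrt_mult_self)
    then show ?thesis by (simp add: real_sqrt_mult)
  qed
  finally show ?thesis .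
qed

lemma sum_mset_inverse_norm_nonneg: "0 \<le> (\<Sum>x\<in>#X. 1 / norm (z - x))"
  by (induction X) auto

lemma nn_integral_sum_mset_inverse_norm_le:
  fixes A :: "complex set"
  assumes A: "A \<in> sets lborel" and m: "emeasure lborel A = ennreal m" "m > 0"
  shows "(\<integral>\<^sup>+z\<in>A. ennreal (\<Sum>x\<in>#X. 1 / norm (z - x)) \<partial>lborel) \<le>
    ennreal (real (size X) * (4 * sqrt (pi * m)))"
proof (induction X)
  case empty
  then show ?case by simp
next
  case (add a X)
  note [measurable] = A
  have sm: "(\<lambda>z. \<Sum>x\<in>#Y. 1 / norm (z - x)) \<in> borel_measurable borel" for Y :: "complex multiset"
    by (induction Y) auto
  have nn: "0 \<le> (\<Sum>x\<in>#X. 1 / norm (z - x))" for z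
    by (rule sum_mset_inverse_norm_nonneg)
  have "(\<integral>\<^sup>+z\<in>A. ennreal (\<Sum>x\<in>#add_mset a X. 1 / norm (z - x)) \<partial>lborel) =
      (\<integral>\<^sup>+z. ennreal (1 / norm (z - a)) * indicator A z +
        ennreal (\<Sum>x\<in>#X. 1 / norm (z - x)) * indicator A z \<partial>lborel)"
    using nn by (intro nn_integral_cong) (auto simp: indicator_def ennreal_plus)
  also have "\<dots> = (\<integral>\<^sup>+z\<in>A. ennreal (1 / norm (z - a)) \<partial>lborel) +
      (\<integral>\<^sup>+z\<in>A. ennreal (\<Sum>x\<in>#X. 1 / norm (z - x)) \<partial>lborel)"
    using sm A by (intro nn_integral_add) auto
  also have "\<dots> \<le> ennreal (4 * sqrt (pi * m)) + ennreal (real (size X) * (4 * sqrt (pi * m)))"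
    by (intro add_mono nn_integral_inverse_norm_le[OF A m] add.IH)
  also have "\<dots> = ennreal (real (size (add_mset a X)) * (4 * sqrt (pi * m)))"
    using m by (subst ennreal_plus[symmetric]) (auto simp: algebra_simps)
  finally show ?case .
qed

text \<open>A sum that is at least \<open>C\<close> throughout \<open>A\<close> off the points of
  \<open>X\<close> would have integral at least \<open>C * m\<close>, contradicting the bound on the
  integral.\<close>

lemma exists_sum_mset_inverse_norm_less:
  fixes A :: "complex set"
  assumes A: "A \<in> sets lborel" and m: "emeasure lborel A = ennreal m" "m > 0"
    and C: "real (size X) * (4 * sqrt (pi * m)) < C * m"
  shows "\<exists>z\<in>A. z \<notin># X \<and> (\<Sum>x\<in>#X. 1 / norm (z - x)) < C"
proof (rule ccontr)
  assume "\<not> ?thesis"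
  then have C_le: "C \<le> (\<Sum>x\<in>#X. 1 / norm (z - x))" if "z \<in> A" "z \<notin># X" for z
    using that by force
  \<comment> \<open>Deleting finitely many points keeps the area, and the integral estimate applies
    to \<open>B\<close> as well as to \<open>A\<close>.\<close>
  define B where "B = A - set_mset X"
  have "set_mset X \<in> null_sets lborel"
    by (intro finite_imp_null_set_lborel) auto
  then have B: "B \<in> sets lborel" "emeasure lborel B = ennreal m"
    using A m by (auto simp: B_def emeasure_Diff_null_set)
  \<comment> \<open>Positivity is needed since \<open>ennreal\<close> truncates negative reals to
    0.\<close>
  have C0: "C > 0"
  proof (rule ccontr)
    assume "\<not> C > 0"
    then have "C * m \<le> 0" using m by (simp add: mult_nonpos_nonneg)
    moreover have "0 \<le> real (size X) * (4 * sqrt (pi * m))" using m by simp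
    ultimately show False using C by linarith
  qed
  have "ennreal (C * m) = (\<integral>\<^sup>+z. ennreal C * indicator B z \<partial>lborel)"
    using B C0 by (subst nn_integral_cmult_indicator) (auto simp: ennreal_mult')
  also have "\<dots> \<le> (\<integral>\<^sup>+z\<in>B. ennreal (\<Sum>x\<in>#X. 1 / norm (z - x)) \<partial>lborel)"
    using C_le by (intro nn_integral_mono) (auto simp: B_def indicator_def intro: ennreal_leI)
  also have "\<dots> \<le> ennreal (real (size X) * (4 * sqrt (pi * m)))"
    by (rule nn_integral_sum_mset_inverse_norm_le) (use B m in auto)
  finally have "C * m \<le> real (size X) * (4 * sqrt (pi * m))"
    using m by (subst (asm) ennreal_le_iff) auto
  then show False using C by simp
qed

section \<open>Variation of a polynomial and its linearisation near a point\<close>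

text \<open>Each factor is \<open>1 + (w - z) / (z - x)\<close>, so the deviation of the product
  from 1 is at most that of the product of the \<open>1 + norm (w - z) / norm (z - x)\<close>, and
  \<open>1 + y \<le> exp y\<close>.\<close>

lemma norm_prod_mset_ratio_minus_1_le:
  fixes z w :: complex
  assumes "z \<notin># X"
  shows "norm ((\<Prod>x\<in>#X. (w - x) / (z - x)) - 1) \<le>
    exp (norm (w - z) * (\<Sum>x\<in>#X. 1 / norm (z - x))) - 1"
  using assms
proof (induction X)
  case empty
  then show ?case by simp
next
  case (add a X)
  define P where "P = (\<Prod>x\<in>#X. (w - x) / (z - x))"
  define E where "E = exp (norm (w - z) * (\<Sum>x\<in>#X. 1 / norm (z - x)))"
  define y where "y = norm (w - z) * (1 / norm (z - a))"
  have za: "z \<noteq> a" and IH: "norm (P - 1) \<le> E - 1"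
    using add by (auto simp: P_def E_def)
  have "norm P \<le> E" using norm_triangle_sub[of P 1] IH by simp
  have "(w - a) / (z - a) * P - 1 = (w - z) / (z - a) * P + (P - 1)"
    using za by (simp add: field_simps)
  then have "norm ((w - a) / (z - a) * P - 1) \<le> norm ((w - z) / (z - a) * P) + norm (P - 1)"
    by (metis norm_triangle_ineq)
  also have "\<dots> \<le> y * E + (E - 1)"
    using IH \<open>norm P \<le> E\<close>
    by (intro add_mono) (auto simp: norm_mult norm_divide y_def intro!: divide_right_mono mult_left_mono)
  also have "\<dots> = (1 + y) * E - 1" by (simp add: algebra_simps)
  also have "\<dots> \<le> exp y * E - 1"
    by (intro diff_right_mono mult_right_mono exp_ge_add_one_self) (auto simp: E_def)
  also have "exp y * E = exp (norm (w - z) * (\<Sum>x\<in>#add_mset a X. 1 / norm (z - x)))"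
    by (simp add: y_def E_def exp_add [symmetric] distrib_left)
  finally show ?case by (simp add: P_def)
qed

text \<open>Factoring \<open>q\<close> over the complex numbers turns
  \<open>poly q w / poly q z\<close> into the product of ratios just estimated.\<close>

lemma norm_poly_diff_le:
  fixes q :: "complex poly"
  assumes q: "q \<noteq> 0" and z: "z \<notin># proots q"
  shows "norm (poly q w - poly q z) \<le>
    norm (poly q z) * (exp (norm (w - z) * (\<Sum>x\<in>#proots q. 1 / norm (z - x))) - 1)"
proof -
  have ev: "poly q u = lead_coeff q * (\<Prod>x\<in>#proots q. u - x)" for u
  proof -
    have "poly q u = poly (smult (lead_coeff q) (\<Prod>x\<in>#proots q. [:-x, 1:])) u"
      using complex_poly_decompose_multiset[of q] by simp
    also have "\<dots> = lead_coeff q * (\<Prod>x\<in>#proots q. u - x)"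
      by (simp add: poly_prod_mset image_mset.compositionality o_def)
    finally show ?thesis .
  qed
  have "(\<Prod>x\<in>#X. z - x) * (\<Prod>x\<in>#X. (w - x) / (z - x)) = (\<Prod>x\<in>#X. w - x)"
    if "z \<notin># X" for X
    using that by (induction X) auto
  from this[OF z] have "poly q w = poly q z * (\<Prod>x\<in>#proots q. (w - x) / (z - x))"
    unfolding ev by (simp add: mult.assoc)
  then have "poly q w - poly q z =
      poly q z * ((\<Prod>x\<in>#proots q. (w - x) / (z - x)) - 1)"
    by (simp add: algebra_simps)
  then show ?thesis
    using norm_prod_mset_ratio_minus_1_le[OF z] by (simp add: norm_mult mult_left_mono)
qed

text \<open>After subtraction of the linear part the derivative at \<open>u\<close> is
  \<open>q'(u) - q'(z)\<close>, which the preceding estimate for \<open>q'\<close> controls; the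
  mean value inequality then bounds the remainder. This is why the zeros of the derivative enter the
  sum.\<close>

lemma norm_poly_minus_linear_le:
  fixes q :: "complex poly"
  assumes q: "pderiv q \<noteq> 0" and z: "z \<notin># proots (pderiv q)"
  shows "norm (poly q w - poly q z - poly (pderiv q) z * (w - z)) \<le>
    norm (poly (pderiv q) z) * norm (w - z) *
      (exp (norm (w - z) * (\<Sum>x\<in>#proots (pderiv q). 1 / norm (z - x))) - 1)"
proof -
  define S where "S = (\<Sum>x\<in>#proots (pderiv q). 1 / norm (z - x))"
  have S: "S \<ge> 0" unfolding S_def by (rule sum_mset_inverse_norm_nonneg)
  let ?f = "\<lambda>u. poly q u - poly (pderiv q) z * u"
  let ?K = "norm (poly (pderiv q) z) * (exp (norm (w - z) * S) - 1)"
  have "norm (?f w - ?f z) \<le> ?K * norm (w - z)"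
  proof (rule field_differentiable_bound[of "cball z (norm (w - z))"])
    fix u assume u: "u \<in> cball z (norm (w - z))"
    show "(?f has_field_derivative (poly (pderiv q) u - poly (pderiv q) z))
        (at u within cball z (norm (w - z)))"
      by (auto intro!: derivative_eq_intros has_field_derivative_at_within[OF poly_DERIV])
    have "norm (u - z) * S \<le> norm (w - z) * S"
      using u S by (intro mult_right_mono) (auto simp: dist_norm norm_minus_commute)
    then have "norm (poly (pderiv q) z) * (exp (norm (u - z) * S) - 1) \<le> ?K"
      by (intro mult_left_mono) auto
    then show "norm (poly (pderiv q) u - poly (pderiv q) z) \<le> ?K"
      using norm_poly_diff_le[OF q z, of u] by (simp add: S_def)
  qed (auto simp: dist_norm norm_minus_commute)
  moreover have "?f w - ?f z = poly q w - poly q z - poly (pderiv q) z * (w - z)"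
    by (simp add: algebra_simps)
  ultimately have "norm (poly q w - poly q z - poly (pderiv q) z * (w - z)) \<le> ?K * norm (w - z)"
    by (simp only:)
  then show ?thesis by (simp add: S_def mult_ac)
qed

section \<open>A disc on which the modulus does not exceed its value at a point\<close>

text \<open>With \<open>v = 1 - p(w) / p(z)\<close> the goal is \<open>norm (1 - v) \<le> 1\<close>,
  that is \<open>(norm v)\<^sup>2 \<le> 2 * Re v\<close>. The zeros of \<open>p\<close> make
  \<open>v\<close> small; those of \<open>p'\<close> make \<open>v\<close> close to its linear part,
  whose real part is positive near the shifted centre.\<close>

lemma ball_subset_norm_poly_le:
  fixes p :: "complex poly"
  assumes p: "p \<noteq> 0" "pderiv p \<noteq> 0"
    and z: "z \<notin># proots p + proots (pderiv p)"
    and M: "(\<Sum>x\<in>#proots p + proots (pderiv p). 1 / norm (z - x)) \<le> M" "M > 0"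
  shows "\<exists>c. ball c (1 / (20 * M)) \<subseteq> {w. norm (poly p w) \<le> norm (poly p z)}"
proof -
  define A where "A = poly p z"
  define B where "B = poly (pderiv p) z"
  have AB: "A \<noteq> 0" "B \<noteq> 0" using z p by (auto simp: A_def B_def)
  define S1 where "S1 = (\<Sum>x\<in>#proots p. 1 / norm (z - x))"
  define S2 where "S2 = (\<Sum>x\<in>#proots (pderiv p). 1 / norm (z - x))"
  have S: "S1 \<le> M" "S2 \<le> M"
    using M sum_mset_inverse_norm_nonneg[of z "proots p"]
      sum_mset_inverse_norm_nonneg[of z "proots (pderiv p)"]
    by (auto simp: S1_def S2_def)
  \<comment> \<open>The disc has radius \<open>D / 2\<close> and its centre lies at distance
    \<open>D\<close> from \<open>z\<close>, so its points are within \<open>3 / 2 * D\<close> of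
    \<open>z\<close> and the exponents stay below \<open>3 / 20\<close>.\<close>
  define D where "D = 1 / (10 * M)"
  have D: "D > 0" using M by (simp add: D_def)
  define b where "b = norm (B / A)"
  have b: "b > 0" using AB by (simp add: b_def)
  \<comment> \<open>Moving from \<open>z\<close> along \<open>- A / B\<close> decreases the modulus
    of the affine approximation: at \<open>c\<close> it equals
    \<open>A * (1 - D * b)\<close>.\<close>
  define c where "c = z - of_real (D * b) * A / B"
  have "ball c (D / 2) \<subseteq> {w. norm (poly p w) \<le> norm (poly p z)}"
  proof safe
    fix w assume w: "w \<in> ball c (D / 2)"
    define s where "s = D * b"
    \<comment> \<open>\<open>\<zeta>\<close> is the linear part of \<open>v\<close>; it equals
      \<open>s\<close> at the centre and stays within \<open>s / 2\<close> of \<open>s\<close> on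
      the disc.\<close>
    define \<zeta> where "\<zeta> = - B * (w - z) / A"
    define v where "v = 1 - poly p w / A"
    define h where "h = exp (3 / 20 :: real) - 1"
    have h: "0 \<le> h" "h \<le> 69 / 400"
    proof -
      have "exp (3 / 20 :: real) \<le> 1 + 3 / 20 + (3 / 20)\<^sup>2"
        by (rule exp_bound) auto
      then show "h \<le> 69 / 400" by (simp add: h_def power2_eq_square)
    qed (simp add: h_def)
    have s: "s > 0" using D b by (simp add: s_def)
    have "\<zeta> - of_real s = (B / A) * (c - w)"
      using AB by (simp add: \<zeta>_def c_def s_def field_simps)
    then have "norm (\<zeta> - of_real s) = b * norm (c - w)"
      by (simp only: norm_mult b_def)
    also have "\<dots> \<le> b * (D / 2)"
      using w b by (intro mult_left_mono) (auto simp: dist_norm)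
    finally have \<zeta>_s: "norm (\<zeta> - of_real s) \<le> s / 2" by (simp add: s_def mult_ac)
    have n\<zeta>: "norm \<zeta> \<le> 3 / 2 * s"
      using norm_triangle_sub[of \<zeta> "of_real s"] \<zeta>_s s by simp
    have "norm \<zeta> = b * norm (w - z)"
      by (simp add: \<zeta>_def b_def norm_mult norm_divide)
    then have "b * norm (w - z) \<le> b * (3 / 2 * D)"
      using n\<zeta> by (simp add: s_def mult_ac)
    then have wz: "norm (w - z) \<le> 3 / 2 * D"
      using b by simp
    have small: "exp (norm (w - z) * T) - 1 \<le> h" if "T \<le> M" for T
    proof -
      have "norm (w - z) * T \<le> norm (w - z) * M"
        using that by (intro mult_left_mono) auto
      also have "\<dots> \<le> 3 / 2 * D * M"
        using wz M by (intro mult_right_mono) auto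
      also have "\<dots> = 3 / 20" using M by (simp add: D_def)
      finally show ?thesis by (simp add: h_def)
    qed
    have "norm (poly p w - A) \<le> norm A * (exp (norm (w - z) * S1) - 1)"
      using norm_poly_diff_le[of p z w] p z by (simp add: A_def S1_def)
    also have "\<dots> \<le> norm A * h"
      by (intro mult_left_mono small S) auto
    finally have "norm (poly p w - A) \<le> norm A * h" .
    moreover have "norm v = norm (poly p w - A) / norm A"
      using AB by (simp add: v_def diff_divide_eq_iff norm_divide norm_minus_commute)
    ultimately have v1: "norm v \<le> h"
      using AB by (simp add: pos_divide_le_eq mult.commute)
    have "norm (poly p w - A - B * (w - z)) \<le>
        norm B * norm (w - z) * (exp (norm (w - z) * S2) - 1)"
      using norm_poly_minus_linear_le[of p z w] p z by (simp add: A_def B_def S2_def)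
    also have "\<dots> \<le> norm B * norm (w - z) * h"
      by (intro mult_left_mono small S) auto
    finally have "norm (poly p w - A - B * (w - z)) \<le> norm B * norm (w - z) * h" .
    moreover have "v - \<zeta> = - (poly p w - A - B * (w - z)) / A"
      using AB by (simp add: v_def \<zeta>_def field_simps)
    ultimately have "norm (v - \<zeta>) \<le> norm B * norm (w - z) * h / norm A"
      by (simp only: norm_divide norm_minus_cancel) (intro divide_right_mono, auto)
    also have "\<dots> = norm \<zeta> * h"
      by (simp add: \<zeta>_def norm_mult norm_divide)
    finally have v\<zeta>: "norm (v - \<zeta>) \<le> norm \<zeta> * h" .
    also have "\<dots> \<le> 3 / 2 * s * h"
      using n\<zeta> h by (intro mult_right_mono) auto
    finally have v2: "norm (v - \<zeta>) \<le> 3 / 2 * s * h" .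
    have nv: "norm v \<le> 3 / 2 * s + 3 / 2 * s * h"
      using norm_triangle_sub[of v \<zeta>] n\<zeta> v2 by linarith
    have "2 * (s / 2 - 3 / 2 * s * h) \<le> 2 * Re v"
    proof (rule mult_left_mono)
      show "s / 2 - 3 / 2 * s * h \<le> Re v"
        using abs_Re_le_cmod[of "v - \<zeta>"] abs_Re_le_cmod[of "\<zeta> - of_real s"] v2 \<zeta>_s by simp
    qed simp
    \<comment> \<open>One factor \<open>norm v\<close> is bounded by a multiple of \<open>s\<close>
      and the other by \<open>h\<close>. Both sides of the comparison are then linear in
      \<open>s\<close>, and cancelling it leaves a numerical inequality in \<open>h\<close>.\<close>
    moreover have "(norm v)\<^sup>2 \<le> (3 / 2 * s + 3 / 2 * s * h) * h"
      unfolding power2_eq_square using nv v1 h s by (intro mult_mono) auto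
    moreover have "(3 / 2 * s + 3 / 2 * s * h) * h \<le> 2 * (s / 2 - 3 / 2 * s * h)"
    proof -
      have "h * h \<le> 69 / 400 * (69 / 400)" using h by (intro mult_mono) auto
      then have "3 / 2 * h + 3 / 2 * (h * h) + 3 * h \<le> 1" using h by linarith
      then have "s * (3 / 2 * h + 3 / 2 * (h * h) + 3 * h) \<le> s * 1"
        using s by (intro mult_left_mono) auto
      then show ?thesis by (simp add: algebra_simps)
    qed
    ultimately have "(norm v)\<^sup>2 \<le> 2 * Re v" by (meson order_trans)
    \<comment> \<open>Expand
      \<open>(norm (1 - v))\<^sup>2 = 1 - 2 * Re v + (norm v)\<^sup>2\<close>.\<close>
    then have "(norm (1 - v))\<^sup>2 \<le> 1\<^sup>2"
      unfolding cmod_power2 by (simp add: power2_eq_square algebra_simps)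
    then have "norm (1 - v) \<le> 1"
      using power2_le_imp_le[of "norm (1 - v)" 1] by simp
    then show "norm (poly p w) \<le> norm (poly p z)"
      using AB by (simp add: v_def norm_divide A_def field_simps)
  qed
  then show ?thesis by (auto simp: D_def)
qed

section \<open>The inradius bound\<close>

lemma inradius_ge:
  assumes "bounded S" "0 \<le> r" "ball c r \<subseteq> S"
  shows "inradius S \<ge> r"
  unfolding inradius_def using assms
  by (intro cSup_upper bdd_above_inradius) auto

theorem lemma9:
  fixes p :: "complex poly" and t :: real and n :: nat
  assumes "t > 0"
    and "degree p = n"
    and "n \<ge> 1"
  shows "inradius (lemniscate p t) \<ge>
    1 / (72 * pi * sqrt pi) * (sqrt (measure lebesgue (lemniscate p t)) / real n)"
proof -
  let ?L = "lemniscate p t"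
  define m where "m = measure lebesgue ?L"
  have bdd: "bounded ?L" using assms by (intro bounded_lemniscate) auto
  have "closed ?L"
    unfolding lemniscate_def by (intro closed_Collect_le continuous_intros)
  then have L: "?L \<in> sets lborel" "compact ?L" using bdd by (auto simp: compact_eq_bounded_closed)
  \<comment> \<open>Compactness makes the area finite, so the real-valued \<open>measure\<close> is
    the true area and not the default 0 for infinite measure.\<close>
  have eL: "emeasure lborel ?L = ennreal m"
    using L emeasure_compact_finite[of ?L]
    by (subst emeasure_eq_ennreal_measure) (auto simp: m_def top_unique)
  have p: "p \<noteq> 0" "pderiv p \<noteq> 0"
    using assms by (auto simp: pderiv_eq_0_iff)
  show ?thesis
  \<comment> \<open>For zero area the claimed bound is 0, attained by an empty disc.\<close>
  proof (cases "m = 0")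
    case True
    then show ?thesis using inradius_ge[OF bdd, of 0] by (simp add: m_def)
  next
    case False
    then have m: "m > 0" unfolding m_def by (simp add: less_le)
    define X where "X = proots p + proots (pderiv p)"
    have X: "real (size X) \<le> 2 * real n"
      using assms by (simp add: X_def size_proots_complex degree_pderiv)
    define r where "r = 1 / (72 * pi * sqrt pi) * (sqrt m / real n)"
    have r: "r > 0" using m assms by (simp add: r_def)
    \<comment> \<open>Chosen so that the disc of radius \<open>1 / (20 * M)\<close> has exactly the
      claimed radius \<open>r\<close>.\<close>
    define M where "M = 1 / (20 * r)"
    have M: "M > 0" using r by (simp add: M_def)
    have "real (size X) * (4 * sqrt (pi * m)) \<le> (2 * real n) * (4 * sqrt (pi * m))"
      using X m by (intro mult_right_mono) auto
    also have "\<dots> = 8 * (real n * sqrt pi * sqrt m)" by (simp add: real_sqrt_mult)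
    \<comment> \<open>The constant 72 is used here: \<open>8 < 72 / 20 * pi\<close> follows from
      \<open>pi > 3\<close>.\<close>
    also have "\<dots> < 72 / 20 * pi * (real n * sqrt pi * sqrt m)"
      using pi_gt3 m assms by (intro mult_strict_right_mono) auto
    also have "\<dots> = M * m"
      using m assms real_sqrt_mult_self[of m]
      by (simp add: M_def r_def field_simps del: real_sqrt_mult_self)
    finally obtain z where z: "z \<in> ?L" "z \<notin># X" "(\<Sum>x\<in>#X. 1 / norm (z - x)) < M"
      using exists_sum_mset_inverse_norm_less[OF L(1) eL m] by blast
    obtain c where "ball c (1 / (20 * M)) \<subseteq> {w. norm (poly p w) \<le> norm (poly p z)}"
      using ball_subset_norm_poly_le[OF p, of z M] z M by (auto simp: X_def)
    \<comment> \<open>Since \<open>z\<close> lies in the lemniscate,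
      \<open>norm (poly p z) \<le> t\<close>.\<close>
    also have "\<dots> \<subseteq> ?L" using z by (auto simp: lemniscate_def)
    also have "1 / (20 * M) = r" using r by (simp add: M_def)
    finally show ?thesis using inradius_ge[OF bdd, of r] r by (auto simp: r_def m_def)
  qed
qed

end
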